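(* Let $\mathcal{M}$ be a Kripke model, and let $ue(\mathcal{M})$ be its ($\forall$-version) ultrafilter extension for contingency logic. Then $ue(\mathcal{M})$ is $\mathcal{L}(\nabla)$-saturated.
   Context: A Kripke model is $\mathcal{M}=\langle S,R,V\rangle$ with $S\neq\emptyset$, $R\subseteq S\times S$, $V:\mathbf{P}\to\mathcal{P}(S)$, where $\mathbf{P}$ is the set of propositional variables. $\mathcal{L}(\nabla)$ is the propositional language with $\neg,\wedge$ and a unary operator $\nabla$ (contingency); $\Delta\phi$ abbreviates $\neg\nabla\phi$. Semantics: $\mathcal{M},s\vDash\nabla\phi$ iff there are $t,u\in S$ with $Rst$, $Rsu$, $\mathcal{M},t\vDash\phi$ and $\mathcal{M},u\nvDash\phi$; Booleans as usual. For $X\subseteq S$, $m_\Delta(X)=\{s\in S\mid\text{for all }t,u,\text{ if }Rst\text{ and }Rsu,\text{ then }(t\in X\text{ iff }u\in X)\}$. Ultrafilter extension ($\forall$-version): $ue(\mathcal{M})=\langle Uf(S),R^{ue},V^{ue}\rangle$, where $Uf(S)$ is the set of all ultrafilters over $S$; $R^{ue}st$ iff for all $Y\subseteq S$, if $m_\Delta(X\cup Y)\in s$ for all $X\subseteq S$, then $Y\in t$; and $V^{ue}(p)=\{s\in Uf(S)\mid V(p)\in s\}$. A Kripke model is $\mathcal{L}(\nabla)$-saturated if for every state $s$ and every $\Gamma\subseteq\mathcal{L}(\nabla)$: if $\Gamma$ is finitely satisfiable in the set of successors of $s$ (every finite subset of $\Gamma$ is true, all formulas simultaneously, at some successor of $s$),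 then $\Gamma$ is satisfiable in the set of successors of $s$ (some successor of $s$ satisfies all of $\Gamma$). *)

theory Defs
  imports Main
begin

datatype 'p form =
    Atom 'p
  | Neg "'p form"
  | Conj "'p form" "'p form"
  | Nabla "'p form"

abbreviation Delta :: "'p form \<Rightarrow> 'p form" where
  "Delta \<phi> \<equiv> Neg (Nabla \<phi>)"

record ('s, 'p) model =
  states :: "'s set"
  rel :: "('s \<times> 's) set"
  val :: "'p \<Rightarrow> 's set"

definition kripke_model :: "('s, 'p) model \<Rightarrow> bool" where
  "kripke_model M \<longleftrightarrow>
     states M \<noteq> {} \<and> rel M \<subseteq> states M \<times> states M \<and> (\<forall>p. val M p \<subseteq> states M)"

primrec holds :: "('s, 'p) model \<Rightarrow> 's \<Rightarrow> 'p form \<Rightarrow> bool" where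
  "holds M s (Atom p) \<longleftrightarrow> s \<in> val M p"
| "holds M s (Neg \<phi>) \<longleftrightarrow> \<not> holds M s \<phi>"
| "holds M s (Conj \<phi> \<psi>) \<longleftrightarrow> holds M s \<phi> \<and> holds M s \<psi>"
| "holds M s (Nabla \<phi>) \<longleftrightarrow>
     (\<exists>t\<in>states M. \<exists>u\<in>states M.
        (s, t) \<in> rel M \<and> (s, u) \<in> rel M \<and> holds M t \<phi> \<and> \<not> holds M u \<phi>)"

definition m_Delta :: "('s, 'p) model \<Rightarrow> 's set \<Rightarrow> 's set" where
  "m_Delta M X =
     {s \<in> states M. \<forall>t u. (s, t) \<in> rel M \<and> (s, u) \<in> rel M \<longrightarrow> (t \<in> X \<longleftrightarrow> u \<in> X)}"

text \<open>
  Ultrafilters over a carrier set, given as families of subsets of it; the filters of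
  \<^theory>\<open>HOL.Filter\<close> live on a whole type instead.
\<close>

definition ultrafilter_over :: "'s set \<Rightarrow> 's set set \<Rightarrow> bool" where
  "ultrafilter_over S U \<longleftrightarrow>
     U \<subseteq> Pow S \<and> S \<in> U \<and> {} \<notin> U \<and>
     (\<forall>X\<in>U. \<forall>Y\<in>U. X \<inter> Y \<in> U) \<and>
     (\<forall>X\<in>U. \<forall>Y. X \<subseteq> Y \<and> Y \<subseteq> S \<longrightarrow> Y \<in> U) \<and>
     (\<forall>X. X \<subseteq> S \<longrightarrow> (X \<in> U \<longleftrightarrow> S - X \<notin> U))"

definition Uf :: "'s set \<Rightarrow> 's set set set" where
  "Uf S = {U. ultrafilter_over S U}"

definition ue :: "('s, 'p) model \<Rightarrow> ('s set set, 'p) model" where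
  "ue M =
     \<lparr> states = Uf (states M),
       rel = {(s, t). s \<in> Uf (states M) \<and> t \<in> Uf (states M) \<and>
                (\<forall>Y. Y \<subseteq> states M \<longrightarrow>
                   (\<forall>X. X \<subseteq> states M \<longrightarrow> m_Delta M (X \<union> Y) \<in> s) \<longrightarrow> Y \<in> t)},
       val = (\<lambda>p. {s \<in> Uf (states M). val M p \<in> s}) \<rparr>"

definition satisfiable_in :: "('s, 'p) model \<Rightarrow> 's set \<Rightarrow> 'p form set \<Rightarrow> bool" where
  "satisfiable_in M T \<Gamma> \<longleftrightarrow> (\<exists>t\<in>T. \<forall>\<phi>\<in>\<Gamma>. holds M t \<phi>)"

definition finitely_satisfiable_in :: "('s, 'p) model \<Rightarrow> 's set \<Rightarrow> 'p form set \<Rightarrow> bool" where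
  "finitely_satisfiable_in M T \<Gamma> \<longleftrightarrow>
     (\<forall>\<Gamma>'. \<Gamma>' \<subseteq> \<Gamma> \<and> finite \<Gamma>' \<longrightarrow> satisfiable_in M T \<Gamma>')"

definition saturated :: "('s, 'p) model \<Rightarrow> bool" where
  "saturated M \<longleftrightarrow>
     (\<forall>s\<in>states M. \<forall>\<Gamma>.
        finitely_satisfiable_in M (rel M `` {s}) \<Gamma> \<longrightarrow> satisfiable_in M (rel M `` {s}) \<Gamma>)"

lemma kripke_model_ue:
  assumes "kripke_model M"
  shows "kripke_model (ue M)"
proof -
  obtain w where w: "w \<in> states M"
    using assms unfolding kripke_model_def by blast
  have "ultrafilter_over (states M) {X. X \<subseteq> states M \<and> w \<in> X}"
    using w unfolding ultrafilter_over_def by auto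
  then show ?thesis
    unfolding kripke_model_def ue_def Uf_def by auto
qed

end

theory Submission imports Defs begin

text \<open>
  For a formula write its truth set for the set of states of the original model where it holds, and
  call \<open>necessary_sets M s\<close> the family of sets \<open>Y\<close> with \<open>m_Delta M (X \<union> Y) \<in> s\<close> for all \<open>X\<close>. By
  definition, the successors of an ultrafilter \<open>s\<close> in the ultrafilter extension are exactly the
  ultrafilters that include this family, so having a successor with prescribed members is a
  question about the finite intersection property, answered by the ultrafilter theorem.

  The link between formulas and ultrafilters is the truth lemma \<open>holds_ue_iff_truth_set_mem\<close>: a
  formula holds at an ultrafilter iff its truth set is a member. The case of contingency rests on
  two facts about a set \<open>A\<close>. If \<open>m_Delta M A \<in> s\<close>, then \<open>A\<close> or its complement is a necessary set,
  because a state whose successors agree on \<open>A\<close> has all of them in \<open>A\<close> or all of them outside;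
  hence all successors of \<open>s\<close> agree on \<open>A\<close>. If \<open>m_Delta M A \<notin> s\<close>, then no necessary set lies inside
  \<open>A\<close> or inside its complement, and since necessary sets are closed under intersection, successors
  with and without \<open>A\<close> exist.

  For saturation, suppose that \<open>\<Gamma>\<close> is finitely satisfiable among the successors of \<open>s\<close>. A finite
  part of \<open>\<Gamma>\<close> holds at a successor, which then contains the truth sets of that part and every
  necessary set. So the necessary sets and the truth sets of all of \<open>\<Gamma>\<close> together have the finite
  intersection property, and an ultrafilter that includes them is a successor satisfying \<open>\<Gamma>\<close>.
\<close>

section \<open>Ultrafilters and the finite intersection property\<close>

text \<open>Intersecting with \<open>S\<close> gives the empty subfamily the right meaning: its intersection is \<open>S\<close>.\<close>

definition fip_on :: "'s set \<Rightarrow> 's set set \<Rightarrow> bool" where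
  "fip_on S F \<longleftrightarrow> F \<subseteq> Pow S \<and> (\<forall>G. finite G \<and> G \<subseteq> F \<longrightarrow> S \<inter> \<Inter>G \<noteq> {})"

lemma Uf_superset:
  "s \<in> Uf S \<Longrightarrow> X \<in> s \<Longrightarrow> X \<subseteq> Y \<Longrightarrow> Y \<subseteq> S \<Longrightarrow> Y \<in> s"
  unfolding Uf_def ultrafilter_over_def by blast

lemma Uf_Int: "s \<in> Uf S \<Longrightarrow> X \<in> s \<Longrightarrow> Y \<in> s \<Longrightarrow> X \<inter> Y \<in> s"
  unfolding Uf_def ultrafilter_over_def by blast

lemma Uf_compl_iff: "s \<in> Uf S \<Longrightarrow> X \<subseteq> S \<Longrightarrow> S - X \<in> s \<longleftrightarrow> X \<notin> s"
  unfolding Uf_def ultrafilter_over_def by blast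

lemma Uf_empty: "s \<in> Uf S \<Longrightarrow> {} \<notin> s"
  unfolding Uf_def ultrafilter_over_def by blast

lemma Uf_top: "s \<in> Uf S \<Longrightarrow> S \<in> s"
  unfolding Uf_def ultrafilter_over_def by blast

lemma Uf_Int_iff:
  assumes "s \<in> Uf S" "X \<subseteq> S" "Y \<subseteq> S"
  shows "X \<inter> Y \<in> s \<longleftrightarrow> X \<in> s \<and> Y \<in> s"
  using assms Uf_superset[OF assms(1), of "X \<inter> Y"] Uf_Int[OF assms(1)] by blast

lemma Uf_finite_Inter:
  assumes U: "U \<in> Uf S" and "finite G" "G \<subseteq> U"
  shows "S \<inter> \<Inter>G \<in> U"
  using assms(2,3)
proof (induction G rule: finite_induct)
  case empty
  then show ?case using Uf_top[OF U] by simp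
next
  case (insert X G)
  then have "X \<inter> (S \<inter> \<Inter>G) \<in> U"
    using Uf_Int[OF U] by simp
  moreover have "S \<inter> \<Inter>(insert X G) = X \<inter> (S \<inter> \<Inter>G)" by blast
  ultimately show ?case by metis
qed

lemma Uf_fip_on:
  assumes "U \<in> Uf S"
  shows "fip_on S U"
proof -
  have "S \<inter> \<Inter>G \<noteq> {}" if "finite G" "G \<subseteq> U" for G
    using Uf_finite_Inter[OF assms that] Uf_empty[OF assms] by auto
  moreover have "U \<subseteq> Pow S"
    using assms unfolding Uf_def ultrafilter_over_def mem_Collect_eq by (elim conjE)
  ultimately show ?thesis unfolding fip_on_def by blast
qed

text \<open>
  A maximal family with the finite intersection property already contains each set that could be
  added to it. In particular it contains every superset of a finite intersection of its members,
  and it contains the complement of each set that it omits, because such a set misses some finite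
  intersection.
\<close>

lemma maximal_fip_on_ultrafilter:
  assumes fip: "fip_on S U"
    and max: "\<And>F. fip_on S F \<Longrightarrow> U \<subseteq> F \<Longrightarrow> F = U"
  shows "ultrafilter_over S U"
proof -
  have memI: "X \<in> U" if "X \<subseteq> S" and meets: "\<And>G. finite G \<Longrightarrow> G \<subseteq> U \<Longrightarrow> S \<inter> \<Inter>G \<inter> X \<noteq> {}" for X
  proof -
    have "S \<inter> \<Inter>H \<noteq> {}" if "finite H" "H \<subseteq> insert X U" for H
      using meets[of "H - {X}"] that by auto
    then have "fip_on S (insert X U)"
      using fip \<open>X \<subseteq> S\<close> unfolding fip_on_def by blast
    from max[OF this] show ?thesis by blast
  qed
  have ne: "S \<inter> \<Inter>G \<noteq> {}" if "finite G" "G \<subseteq> U" for G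
    using fip that unfolding fip_on_def by blast
  have superset: "X \<in> U" if "X \<subseteq> S" "finite G" "G \<subseteq> U" "S \<inter> \<Inter>G \<subseteq> X" for X G
  proof (rule memI)
    fix H assume "finite H" "H \<subseteq> U"
    then have "S \<inter> \<Inter>(G \<union> H) \<noteq> {}" using ne that by simp
    moreover have "S \<inter> \<Inter>(G \<union> H) \<subseteq> S \<inter> \<Inter>H \<inter> X" using that by blast
    ultimately show "S \<inter> \<Inter>H \<inter> X \<noteq> {}" by blast
  qed fact
  have sub: "U \<subseteq> Pow S" using fip unfolding fip_on_def by blast
  have "S \<in> U" using superset[of S "{}"] by simp
  moreover have "{} \<notin> U" using ne[of "{{}}"] by auto
  moreover have "\<forall>X\<in>U. \<forall>Y\<in>U. X \<inter> Y \<in> U"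
  proof (intro ballI)
    fix X Y assume "X \<in> U" "Y \<in> U"
    then show "X \<inter> Y \<in> U"
      using superset[of "X \<inter> Y" "{X, Y}"] sub by auto
  qed
  moreover have "\<forall>X\<in>U. \<forall>Y. X \<subseteq> Y \<and> Y \<subseteq> S \<longrightarrow> Y \<in> U"
  proof (intro ballI allI impI)
    fix X Y assume "X \<in> U" "X \<subseteq> Y \<and> Y \<subseteq> S"
    then show "Y \<in> U" using superset[of Y "{X}"] by auto
  qed
  moreover have "\<forall>X. X \<subseteq> S \<longrightarrow> (X \<in> U \<longleftrightarrow> S - X \<notin> U)"
  proof (intro allI impI iffI)
    fix X assume "X \<in> U"
    then show "S - X \<notin> U" using ne[of "{X, S - X}"] by auto
  next
    fix X assume "X \<subseteq> S" "S - X \<notin> U"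
    then obtain G where "finite G" "G \<subseteq> U" "S \<inter> \<Inter>G \<inter> (S - X) = {}"
      using memI[of "S - X"] by blast
    then show "X \<in> U" using superset[of X G] \<open>X \<subseteq> S\<close> by blast
  qed
  ultimately show ?thesis
    using sub unfolding ultrafilter_over_def by (intro conjI)
qed

text \<open>
  The ultrafilter theorem, by Zorn's lemma: a finite subfamily of the union of a chain lies in one
  member of the chain, so the union inherits the finite intersection property.
\<close>

lemma fip_on_extends_to_ultrafilter:
  assumes "fip_on S F"
  obtains U where "ultrafilter_over S U" "F \<subseteq> U"
proof -
  let ?P = "{E. fip_on S E \<and> F \<subseteq> E}"
  have "\<exists>U\<in>?P. \<forall>E\<in>?P. U \<subseteq> E \<longrightarrow> E = U"
  proof (rule subset_Zorn_nonempty)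
    show "?P \<noteq> {}" using assms by blast
  next
    fix C assume "C \<noteq> {}" and chain: "subset.chain ?P C"
    then have C: "\<And>E. E \<in> C \<Longrightarrow> fip_on S E \<and> F \<subseteq> E"
      unfolding subset.chain_def by blast
    have "S \<inter> \<Inter>G \<noteq> {}" if "finite G" "G \<subseteq> \<Union>C" for G
    proof -
      from that \<open>C \<noteq> {}\<close> chain obtain E where "E \<in> C" "G \<subseteq> E"
        by (rule finite_subset_Union_chain)
      then show ?thesis using C that unfolding fip_on_def by blast
    qed
    moreover have "\<Union>C \<subseteq> Pow S" using C unfolding fip_on_def by blast
    ultimately have "fip_on S (\<Union>C)" unfolding fip_on_def by blast
    then show "\<Union>C \<in> ?P" using C \<open>C \<noteq> {}\<close> by blast
  qed
  then obtain U where U: "U \<in> ?P" and max: "\<forall>E\<in>?P. U \<subseteq> E \<longrightarrow> E = U"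
    by (rule bexE)
  have "ultrafilter_over S U"
  proof (rule maximal_fip_on_ultrafilter)
    show "fip_on S U" using U by simp
    show "E = U" if "fip_on S E" "U \<subseteq> E" for E
    proof -
      have "E \<in> ?P" using U that by auto
      with max \<open>U \<subseteq> E\<close> show ?thesis by metis
    qed
  qed
  with U show thesis using that[of U] by blast
qed

section \<open>Successors in the ultrafilter extension\<close>

definition necessary_sets :: "('s, 'p) model \<Rightarrow> 's set set \<Rightarrow> 's set set" where
  "necessary_sets M s =
     {Y. Y \<subseteq> states M \<and> (\<forall>X. X \<subseteq> states M \<longrightarrow> m_Delta M (X \<union> Y) \<in> s)}"

lemma states_ue [simp]: "states (ue M) = Uf (states M)"
  by (simp add: ue_def)

lemma rel_ue_iff:
  "(s, t) \<in> rel (ue M) \<longleftrightarrow>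
     s \<in> Uf (states M) \<and> t \<in> Uf (states M) \<and> necessary_sets M s \<subseteq> t"
  by (auto simp: ue_def necessary_sets_def)

lemma m_Delta_subset: "m_Delta M X \<subseteq> states M"
  by (auto simp: m_Delta_def)

lemma m_Delta_compl:
  assumes "kripke_model M"
  shows "m_Delta M (states M - X) = m_Delta M X"
  using assms unfolding m_Delta_def kripke_model_def by blast

text \<open>
  Union distributes over intersection, and a state whose successors agree on two sets has
  successors that agree on their intersection.
\<close>

lemma necessary_sets_Int:
  assumes "s \<in> Uf (states M)" "Y \<in> necessary_sets M s" "Z \<in> necessary_sets M s"
  shows "Y \<inter> Z \<in> necessary_sets M s"
proof -
  have "m_Delta M (X \<union> Y \<inter> Z) \<in> s" if "X \<subseteq> states M" for X
  proof (rule Uf_superset[OF assms(1)])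
    show "m_Delta M (X \<union> Y) \<inter> m_Delta M (X \<union> Z) \<in> s"
      using assms that by (intro Uf_Int[OF assms(1)]) (auto simp: necessary_sets_def)
    show "m_Delta M (X \<union> Y) \<inter> m_Delta M (X \<union> Z) \<subseteq> m_Delta M (X \<union> Y \<inter> Z)"
      unfolding m_Delta_def by blast
  qed (rule m_Delta_subset)
  then show ?thesis using assms unfolding necessary_sets_def by blast
qed

lemma states_necessary:
  assumes "kripke_model M" "s \<in> Uf (states M)"
  shows "states M \<in> necessary_sets M s"
proof -
  have "m_Delta M (X \<union> states M) = states M" for X
    using assms(1) unfolding m_Delta_def kripke_model_def by blast
  then show ?thesis
    using Uf_top[OF assms(2)] by (simp add: necessary_sets_def)
qed

lemma necessary_sets_finite_Inter:
  assumes "kripke_model M" "s \<in> Uf (states M)" "finite G" "G \<subseteq> necessary_sets M s"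
  shows "states M \<inter> \<Inter>G \<in> necessary_sets M s"
  using assms(3,4)
proof (induction G rule: finite_induct)
  case empty
  then show ?case using states_necessary[OF assms(1,2)] by simp
next
  case (insert Y G)
  then have "Y \<inter> (states M \<inter> \<Inter>G) \<in> necessary_sets M s"
    using necessary_sets_Int[OF assms(2)] by simp
  moreover have "states M \<inter> \<Inter>(insert Y G) = Y \<inter> (states M \<inter> \<Inter>G)" by blast
  ultimately show ?case by metis
qed

text \<open>
  If neither were necessary, there would be \<open>X\<close> and \<open>Y\<close> with \<open>m_Delta M (X \<union> A)\<close> and \<open>m_Delta M (Y \<union> (states M - A))\<close>
  both outside \<open>s\<close>. Yet these two sets cover \<open>m_Delta M A\<close>: a state all of whose successors lie in
  \<open>A\<close> is in the first, one all of whose successors avoid \<open>A\<close> is in the second.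
\<close>

lemma m_Delta_mem_imp_necessary:
  assumes M: "kripke_model M" and s: "s \<in> Uf (states M)" and mem: "m_Delta M A \<in> s"
    and A: "A \<subseteq> states M"
  shows "A \<in> necessary_sets M s \<or> states M - A \<in> necessary_sets M s"
proof (rule ccontr)
  assume "\<not> ?thesis"
  then obtain X Y where X: "m_Delta M (X \<union> A) \<notin> s" and Y: "m_Delta M (Y \<union> (states M - A)) \<notin> s"
    using A unfolding necessary_sets_def by auto
  let ?C = "(states M - m_Delta M (X \<union> A)) \<inter> (states M - m_Delta M (Y \<union> (states M - A)))"
  have "?C \<in> s"
    using X Y by (intro Uf_Int[OF s]) (simp_all add: Uf_compl_iff[OF s] m_Delta_subset)
  then have "?C \<inter> m_Delta M A \<in> s" using mem by (rule Uf_Int[OF s])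
  moreover have "?C \<inter> m_Delta M A = {}"
    using M unfolding m_Delta_def kripke_model_def by blast
  ultimately show False using Uf_empty[OF s] by simp
qed

text \<open>
  If a necessary set \<open>Y\<close> were disjoint from \<open>A\<close>, it would be absorbed by the complement of \<open>A\<close>, and
  taking this complement for \<open>X\<close> in the definition of necessity would put
  \<open>m_Delta M (states M - A) = m_Delta M A\<close> into \<open>s\<close>.
\<close>

lemma successor_containing:
  assumes M: "kripke_model M" and s: "s \<in> Uf (states M)" and nmem: "m_Delta M A \<notin> s"
    and A: "A \<subseteq> states M"
  obtains t where "(s, t) \<in> rel (ue M)" "A \<in> t"
proof -
  have meets: "Y \<inter> A \<noteq> {}" if "Y \<in> necessary_sets M s" for Y
  proof
    assume "Y \<inter> A = {}"
    then have "(states M - A) \<union> Y = states M - A"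
      using that unfolding necessary_sets_def by blast
    moreover have "m_Delta M ((states M - A) \<union> Y) \<in> s"
      using that unfolding necessary_sets_def by blast
    ultimately show False using nmem m_Delta_compl[OF M] by metis
  qed
  have "states M \<inter> \<Inter>G \<noteq> {}" if "finite G" "G \<subseteq> insert A (necessary_sets M s)" for G
  proof -
    have "states M \<inter> \<Inter>(G - {A}) \<in> necessary_sets M s"
      using that by (intro necessary_sets_finite_Inter[OF M s]) auto
    from meets[OF this] show ?thesis by blast
  qed
  moreover have "insert A (necessary_sets M s) \<subseteq> Pow (states M)"
    using A unfolding necessary_sets_def by blast
  ultimately have "fip_on (states M) (insert A (necessary_sets M s))"
    unfolding fip_on_def by blast
  then obtain t where "ultrafilter_over (states M) t" "insert A (necessary_sets M s) \<subseteq> t"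
    by (rule fip_on_extends_to_ultrafilter)
  then show thesis using that s by (auto simp: rel_ue_iff Uf_def)
qed

lemma m_Delta_mem_iff_successors_agree:
  assumes M: "kripke_model M" and s: "s \<in> Uf (states M)" and A: "A \<subseteq> states M"
  shows "m_Delta M A \<in> s \<longleftrightarrow>
    (\<forall>t u. (s, t) \<in> rel (ue M) \<and> (s, u) \<in> rel (ue M) \<longrightarrow> (A \<in> t \<longleftrightarrow> A \<in> u))"
    (is "?L \<longleftrightarrow> ?R")
proof
  assume ?L
  then consider "A \<in> necessary_sets M s" | "states M - A \<in> necessary_sets M s"
    using m_Delta_mem_imp_necessary[OF M s _ A] by blast
  then show ?R
  proof cases
    case 1
    then show ?thesis by (auto simp: rel_ue_iff)
  next
    case 2
    then have "A \<notin> t" if "(s, t) \<in> rel (ue M)" for t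
      using that Uf_compl_iff[OF _ A, of t] by (auto simp: rel_ue_iff)
    then show ?thesis by blast
  qed
next
  assume agree: ?R
  show ?L
  proof (rule ccontr)
    assume n: "\<not> ?L"
    obtain t where t: "(s, t) \<in> rel (ue M)" "A \<in> t"
      using successor_containing[OF M s n A] .
    from n have n': "m_Delta M (states M - A) \<notin> s" by (simp add: m_Delta_compl[OF M])
    obtain u where u: "(s, u) \<in> rel (ue M)" "states M - A \<in> u"
      using successor_containing[OF M s n' Diff_subset] .
    then have "A \<notin> u"
      using Uf_compl_iff[OF _ A, of u] by (simp add: rel_ue_iff)
    then show False using agree t u by blast
  qed
qed

section \<open>Truth at ultrafilters\<close>

definition truth_set :: "('s, 'p) model \<Rightarrow> 'p form \<Rightarrow> 's set" where
  "truth_set M \<phi> = {w \<in> states M. holds M w \<phi>}"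

lemma truth_set_subset: "truth_set M \<phi> \<subseteq> states M"
  by (auto simp: truth_set_def)

lemma truth_set_Nabla:
  assumes "kripke_model M"
  shows "truth_set M (Nabla \<phi>) = states M - m_Delta M (truth_set M \<phi>)"
proof -
  have "t \<in> states M" if "(w, t) \<in> rel M" for w t
    using assms that unfolding kripke_model_def by blast
  then have "holds M w (Nabla \<phi>) \<longleftrightarrow> w \<notin> m_Delta M (truth_set M \<phi>)" if "w \<in> states M" for w
    using that by (simp add: truth_set_def m_Delta_def) meson
  then show ?thesis by (auto simp: truth_set_def)
qed

lemma holds_ue_iff_truth_set_mem:
  assumes M: "kripke_model M" and "s \<in> Uf (states M)"
  shows "holds (ue M) s \<phi> \<longleftrightarrow> truth_set M \<phi> \<in> s"
  using assms(2)
proof (induction \<phi> arbitrary: s)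
  case (Atom p)
  have "truth_set M (Atom p) = val M p"
    using M by (auto simp: truth_set_def kripke_model_def)
  then show ?case using Atom by (simp add: ue_def)
next
  case (Neg \<phi>)
  have "truth_set M (Neg \<phi>) = states M - truth_set M \<phi>"
    by (auto simp: truth_set_def)
  then show ?case using Neg by (simp add: Uf_compl_iff truth_set_subset)
next
  case (Conj \<phi> \<psi>)
  have "truth_set M (Conj \<phi> \<psi>) = truth_set M \<phi> \<inter> truth_set M \<psi>"
    by (auto simp: truth_set_def)
  then show ?case using Conj by (simp add: Uf_Int_iff truth_set_subset)
next
  case (Nabla \<phi>)
  have "truth_set M (Nabla \<phi>) \<in> s \<longleftrightarrow> m_Delta M (truth_set M \<phi>) \<notin> s"
    using Nabla.prems by (simp add: truth_set_Nabla[OF M] Uf_compl_iff m_Delta_subset)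
  also have "\<dots> \<longleftrightarrow> (\<exists>t u. (s, t) \<in> rel (ue M) \<and> (s, u) \<in> rel (ue M) \<and>
      truth_set M \<phi> \<in> t \<and> truth_set M \<phi> \<notin> u)"
    unfolding m_Delta_mem_iff_successors_agree[OF M Nabla.prems truth_set_subset] by blast
  also have "\<dots> \<longleftrightarrow> holds (ue M) s (Nabla \<phi>)"
    using Nabla.IH by (auto simp: rel_ue_iff)
  finally show ?case by simp
qed

section \<open>Saturation\<close>

theorem proposition25:
  fixes M :: "('s, 'p) model"
  assumes "kripke_model M"
  shows "saturated (ue M)"
  unfolding saturated_def
proof (intro ballI allI impI)
  fix s and \<Gamma> :: "'p form set"
  assume "s \<in> states (ue M)"
    and fin: "finitely_satisfiable_in (ue M) (rel (ue M) `` {s}) \<Gamma>"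
  then have s: "s \<in> Uf (states M)" by simp
  let ?F = "necessary_sets M s \<union> truth_set M ` \<Gamma>"
  have "states M \<inter> \<Inter>G \<noteq> {}" if G: "finite G" "G \<subseteq> ?F" for G
  proof -
    have "finite (G - necessary_sets M s)" "G - necessary_sets M s \<subseteq> truth_set M ` \<Gamma>"
      using G by auto
    then obtain \<Delta> where \<Delta>: "\<Delta> \<subseteq> \<Gamma>" "finite \<Delta>" "G - necessary_sets M s = truth_set M ` \<Delta>"
      by (meson finite_subset_image)
    then obtain t where t: "(s, t) \<in> rel (ue M)" "\<forall>\<phi>\<in>\<Delta>. holds (ue M) t \<phi>"
      using fin unfolding finitely_satisfiable_in_def satisfiable_in_def by blast
    then have uf: "t \<in> Uf (states M)" and "necessary_sets M s \<subseteq> t"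
      by (simp_all add: rel_ue_iff)
    have "truth_set M ` \<Delta> \<subseteq> t"
      using t(2) holds_ue_iff_truth_set_mem[OF assms uf] by blast
    moreover have "G \<subseteq> necessary_sets M s \<union> truth_set M ` \<Delta>"
      using \<Delta>(3) by (simp add: Diff_subset_conv[symmetric])
    ultimately have "G \<subseteq> t"
      using \<open>necessary_sets M s \<subseteq> t\<close> by (meson Un_least order_trans)
    then show ?thesis
      using Uf_fip_on[OF uf] G(1) unfolding fip_on_def by blast
  qed
  moreover have "?F \<subseteq> Pow (states M)"
    by (auto simp: necessary_sets_def truth_set_def)
  ultimately have "fip_on (states M) ?F" unfolding fip_on_def by blast
  then obtain t where "ultrafilter_over (states M) t" and F: "?F \<subseteq> t"
    by (rule fip_on_extends_to_ultrafilter)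
  then have uf: "t \<in> Uf (states M)" by (simp add: Uf_def)
  have "(s, t) \<in> rel (ue M)" using s uf F by (simp add: rel_ue_iff)
  moreover have "\<forall>\<phi>\<in>\<Gamma>. holds (ue M) t \<phi>"
    using F holds_ue_iff_truth_set_mem[OF assms uf] by blast
  ultimately show "satisfiable_in (ue M) (rel (ue M) `` {s}) \<Gamma>"
    unfolding satisfiable_in_def by blast
qed

end
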